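(* Let $0<\alpha<1$. Then, for $f\in\mathcal{S}(\mathbb{R})$, (i) $k_\alpha^Hf=(-\Delta)^{-\alpha/2}f$; (ii) $k_\alpha f=\cot\frac{\pi\alpha}{2}\,(-\Delta)^{-\alpha/2}f$; (iii) $H_\alpha f=\frac{1}{2\sin\frac{\pi\alpha}{2}}\big((D_{\rm right})^{-\alpha}f-(D_{\rm left})^{-\alpha}f\big)$; (iv) $H_\alpha f=(-\Delta)^{-\alpha/2}Hf$, where $H$ denotes the Hilbert transform on $\mathbb{R}$.
   Context: For $0<\alpha<1$, define $$k_\alpha f(x)=\frac{1}{2\Gamma(\alpha)\sin\frac{\pi\alpha}{2}}\int_{\mathbb{R}}\frac{f(y)}{|x-y|^{1-\alpha}}\,dy,\qquad k_\alpha^Hf(x)=\frac{1}{\pi}\Gamma(1-\alpha)\sin\tfrac{\pi\alpha}{2}\int_{\mathbb{R}}\frac{f(y)}{|x-y|^{1-\alpha}}\,dy,$$ $$H_\alpha f(x)=\frac{1}{2\Gamma(\alpha)\sin\frac{\pi\alpha}{2}}\int_{\mathbb{R}}\frac{f(t)\,\mathrm{sign}(t-x)}{|t-x|^{1-\alpha}}\,dt,$$ $$(D_{\rm right})^{-\alpha}f(x)=\frac{1}{\Gamma(\alpha)}\int_0^\infty\frac{f(x+t)}{t^{1-\alpha}}\,dt,\qquad(D_{\rm left})^{-\alpha}f(x)=\frac{1}{\Gamma(\alpha)}\int_0^\infty\frac{f(x-t)}{t^{1-\alpha}}\,dt.$$ For $0<\beta<1/2$, $(-\Delta)^{-\beta}f=\frac{1}{\Gamma(\beta)}\int_0^\infty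 e^{t\Delta}f\,\frac{dt}{t^{1-\beta}}$, where $\Delta=d^2/dx^2$ and $e^{t\Delta}$ is the classical heat semigroup on $\mathbb{R}$ (Fourier multiplier $e^{-t\xi^2}$). The Fourier transform is $\widehat u(\xi)=\frac{1}{(2\pi)^{1/2}}\int_{\mathbb{R}}u(x)e^{-ix\xi}\,dx$. The Hilbert transform is normalized by $\widehat{Hf}(\xi)=i\,\mathrm{sign}(\xi)\widehat f(\xi)$, i.e. $Hf(x)=\frac1\pi\,\mathrm{P.V.}\int_{\mathbb{R}}\frac{f(t)}{t-x}\,dt$. *)

theory Defs
  imports "HOL-Probability.Probability"
begin

definition nth_vderiv :: "nat \<Rightarrow> (real \<Rightarrow> complex) \<Rightarrow> real \<Rightarrow> complex" where
  "nth_vderiv n f = ((\<lambda>g x. vector_derivative g (at x)) ^^ n) f"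

definition schwartz :: "(real \<Rightarrow> complex) set" where
  "schwartz = {f. \<forall>n. (\<forall>x. nth_vderiv n f differentiable (at x)) \<and>
                      (\<forall>k::nat. bounded (range (\<lambda>x. x ^ k *\<^sub>R nth_vderiv n f x)))}"

definition fourier :: "(real \<Rightarrow> complex) \<Rightarrow> real \<Rightarrow> complex" where
  "fourier u \<xi> = (1 / sqrt (2 * pi)) *\<^sub>R
     (\<integral>x. u x * exp (- \<i> * complex_of_real (x * \<xi>)) \<partial>lborel)"

definition k_op :: "real \<Rightarrow> (real \<Rightarrow> complex) \<Rightarrow> real \<Rightarrow> complex" where
  "k_op \<alpha> f x = (1 / (2 * Gamma \<alpha> * sin (pi * \<alpha> / 2))) *\<^sub>R
     (\<integral>y. f y /\<^sub>R (\<bar>x - y\<bar> powr (1 - \<alpha>)) \<partial>lborel)"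

definition kH_op :: "real \<Rightarrow> (real \<Rightarrow> complex) \<Rightarrow> real \<Rightarrow> complex" where
  "kH_op \<alpha> f x = (1 / pi * Gamma (1 - \<alpha>) * sin (pi * \<alpha> / 2)) *\<^sub>R
     (\<integral>y. f y /\<^sub>R (\<bar>x - y\<bar> powr (1 - \<alpha>)) \<partial>lborel)"

definition H_op :: "real \<Rightarrow> (real \<Rightarrow> complex) \<Rightarrow> real \<Rightarrow> complex" where
  "H_op \<alpha> f x = (1 / (2 * Gamma \<alpha> * sin (pi * \<alpha> / 2))) *\<^sub>R
     (\<integral>t. (sgn (t - x) *\<^sub>R f t) /\<^sub>R (\<bar>t - x\<bar> powr (1 - \<alpha>)) \<partial>lborel)"

definition D_right_neg :: "real \<Rightarrow> (real \<Rightarrow> complex) \<Rightarrow> real \<Rightarrow> complex" where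
  "D_right_neg \<alpha> f x = (1 / Gamma \<alpha>) *\<^sub>R
     (LINT t:{0<..}|lborel. f (x + t) /\<^sub>R (t powr (1 - \<alpha>)))"

definition D_left_neg :: "real \<Rightarrow> (real \<Rightarrow> complex) \<Rightarrow> real \<Rightarrow> complex" where
  "D_left_neg \<alpha> f x = (1 / Gamma \<alpha>) *\<^sub>R
     (LINT t:{0<..}|lborel. f (x - t) /\<^sub>R (t powr (1 - \<alpha>)))"

definition heat_kernel :: "real \<Rightarrow> real \<Rightarrow> real" where
  "heat_kernel t z = exp (- (z\<^sup>2) / (4 * t)) / sqrt (4 * pi * t)"

text \<open>The semigroup is given by convolution with the Gauss--Weierstrass kernel rather than by
  inverting a Fourier integral, because it must also act on Hilbert transforms of Schwartz
  functions. These decay only like \<open>1/x\<close>, so their Fourier integral need not converge absolutely.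
  The lemma \<open>fourier_heat\<close> below gives the multiplier on integrable functions.\<close>

definition heat :: "real \<Rightarrow> (real \<Rightarrow> complex) \<Rightarrow> real \<Rightarrow> complex" where
  "heat t f x = (\<integral>y. heat_kernel t (x - y) *\<^sub>R f y \<partial>lborel)"

text \<open>\<open>neg_laplacian_neg_power \<beta>\<close> is \<open>(- \<Delta>)\<close> to the power \<open>- \<beta>\<close>, for \<open>0 < \<beta> < 1/2\<close>.\<close>

definition neg_laplacian_neg_power :: "real \<Rightarrow> (real \<Rightarrow> complex) \<Rightarrow> real \<Rightarrow> complex" where
  "neg_laplacian_neg_power \<beta> f x = (1 / Gamma \<beta>) *\<^sub>R
     (LINT t:{0<..}|lborel. heat t f x /\<^sub>R (t powr (1 - \<beta>)))"

text \<open>The sign convention \<open>t - x\<close> (not \<open>x - t\<close>) corresponds to the multiplier \<open>\<i> sgn \<xi>\<close>.\<close>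

definition hilbert :: "(real \<Rightarrow> complex) \<Rightarrow> real \<Rightarrow> complex" where
  "hilbert f x = (1 / pi) *\<^sub>R
     Lim (at_right 0) (\<lambda>\<epsilon>. LINT t:{t. \<epsilon> < \<bar>t - x\<bar>}|lborel. f t /\<^sub>R (t - x))"

lemma heat_kernel_eq_normal_density:
  assumes "t > 0"
  shows "heat_kernel t z = normal_density 0 (sqrt (2 * t)) z"
  using assms by (simp add: heat_kernel_def normal_density_def mult.commute mult.left_commute)

lemma heat_kernel_fourier_integral:
  assumes t: "t > 0"
  shows "(\<integral>z. heat_kernel t z *\<^sub>R exp (- \<i> * complex_of_real (z * \<xi>)) \<partial>lborel) = exp (- t * \<xi>\<^sup>2)"
proof -
  define s where "s = sqrt (2 * t)"
  have s: "s > 0" "s\<^sup>2 = 2 * t" using t by (auto simp: s_def)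
  have "(\<integral>z. heat_kernel t z *\<^sub>R exp (- \<i> * complex_of_real (z * \<xi>)) \<partial>lborel) =
        s *\<^sub>R (\<integral>z. heat_kernel t (0 + s * z) *\<^sub>R exp (- \<i> * complex_of_real ((0 + s * z) * \<xi>)) \<partial>lborel)"
    using s by (subst lborel_integral_real_affine[of s _ 0]) auto
  also have "\<dots> = (\<integral>z. s *\<^sub>R (heat_kernel t (s * z) *\<^sub>R exp (- \<i> * complex_of_real ((s * z) * \<xi>))) \<partial>lborel)"
    by (simp only: integral_scaleR_right add_0)
  also have "\<dots> = (\<integral>z. std_normal_density z *\<^sub>R exp (\<i> * complex_of_real ((- s * \<xi>) * z)) \<partial>lborel)"
  proof (rule Bochner_Integration.integral_cong[OF refl])
    fix z
    have "sqrt (2 * pi * s\<^sup>2) = s * sqrt (2 * pi)"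
      using s(1) by (simp add: real_sqrt_mult)
    then have "s * heat_kernel t (s * z) = std_normal_density z"
      using s(1) unfolding heat_kernel_eq_normal_density[OF t] s_def[symmetric] normal_density_def
      by (simp add: power_mult_distrib)
    moreover have "- \<i> * complex_of_real ((s * z) * \<xi>) = \<i> * complex_of_real ((- s * \<xi>) * z)"
      by simp
    ultimately show "s *\<^sub>R (heat_kernel t (s * z) *\<^sub>R exp (- \<i> * complex_of_real ((s * z) * \<xi>)))
        = std_normal_density z *\<^sub>R exp (\<i> * complex_of_real ((- s * \<xi>) * z))"
      by (simp only: scaleR_scaleR)
  qed
  also have "\<dots> = char std_normal_distribution (- s * \<xi>)"
    unfolding char_def by (subst integral_density) auto
  also have "\<dots> = exp (- t * \<xi>\<^sup>2)"
    unfolding char_std_normal_distribution using s by (simp add: power_mult_distrib exp_of_real[symmetric])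
  finally show ?thesis .
qed

lemma fourier_heat:
  assumes t: "t > 0" and f: "integrable lborel f"
  shows "fourier (heat t f) \<xi> = exp (- t * \<xi>\<^sup>2) *\<^sub>R fourier f \<xi>"
proof -
  let ?e = "\<lambda>x. exp (- \<i> * complex_of_real (x * \<xi>))"
  let ?g = "\<lambda>y x. heat_kernel t (x - y) *\<^sub>R f y * ?e x"
  have [measurable]: "f \<in> borel_measurable borel"
    using borel_measurable_integrable[OF f] by simp
  have [measurable]: "heat_kernel t \<in> borel_measurable borel"
    unfolding heat_kernel_def by measurable
  have kint: "integrable lborel (heat_kernel t)"
    using t by (simp add: heat_kernel_eq_normal_density[OF t, abs_def])
  have knn: "heat_kernel t z \<ge> 0" for z
    using t by (simp add: heat_kernel_def)
  have shift: "integrable lborel (\<lambda>x. heat_kernel t (x - y))" for y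
    using lborel_integrable_real_affine[OF kint, of 1 "- y"] by simp
  have shiftI: "(\<integral>x. heat_kernel t (x - y) \<partial>lborel) = (\<integral>x. heat_kernel t x \<partial>lborel)" for y
    by (subst (2) lborel_integral_real_affine[of 1 _ "- y"]) auto
  have normg: "norm (?g y x) = norm (f y) * heat_kernel t (x - y)" for x y
    using knn[of "x - y"] by (simp add: norm_mult)
  have gint: "integrable (lborel \<Otimes>\<^sub>M lborel) (case_prod ?g)"
  proof (rule lborel_pair.Fubini_integrable)
    show "case_prod ?g \<in> borel_measurable (lborel \<Otimes>\<^sub>M lborel)"
      by measurable
    show "integrable lborel (\<lambda>y. \<integral>x. norm (case_prod ?g (y, x)) \<partial>lborel)"
      using f by (simp only: prod.case normg integral_mult_right_zero shiftI) (simp add: integrable_norm)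
    show "AE y in lborel. integrable lborel (\<lambda>x. case_prod ?g (y, x))"
    proof (rule AE_I2)
      fix y
      have "integrable lborel (\<lambda>x. norm (f y) * heat_kernel t (x - y))"
        using shift by simp
      then show "integrable lborel (\<lambda>x. case_prod ?g (y, x))"
        by (rule Bochner_Integration.integrable_bound) (simp_all add: norm_mult knn)
    qed
  qed
  have "(\<integral>x. heat t f x * ?e x \<partial>lborel) = (\<integral>x. (\<integral>y. ?g y x \<partial>lborel) \<partial>lborel)"
    unfolding heat_def by (simp only: integral_mult_left_zero)
  also have "\<dots> = (\<integral>y. (\<integral>x. ?g y x \<partial>lborel) \<partial>lborel)"
    by (rule lborel_pair.Fubini_integral[OF gint])
  also have "\<dots> = (\<integral>y. exp (- t * \<xi>\<^sup>2) * (f y * ?e y) \<partial>lborel)"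
  proof (rule Bochner_Integration.integral_cong[OF refl])
    fix y
    have "(\<integral>x. ?g y x \<partial>lborel) = (\<integral>z. (f y * ?e y) * (heat_kernel t z *\<^sub>R ?e z) \<partial>lborel)"
    proof -
      have "?e (y + z) = ?e y * ?e z" for z
        by (simp add: exp_add[symmetric] algebra_simps)
      then have *: "?g y (y + 1 * z) = (f y * ?e y) * (heat_kernel t z *\<^sub>R ?e z)" for z
        by (simp only: mult_1) simp
      have "(\<integral>x. ?g y x \<partial>lborel) = \<bar>1\<bar> *\<^sub>R (\<integral>z. ?g y (y + 1 * z) \<partial>lborel)"
        by (rule lborel_integral_real_affine) simp
      then show ?thesis
        unfolding * by simp
    qed
    also have "\<dots> = (f y * ?e y) * (\<integral>z. heat_kernel t z *\<^sub>R ?e z \<partial>lborel)"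
      by (rule integral_mult_right_zero)
    finally show "(\<integral>x. ?g y x \<partial>lborel) = exp (- t * \<xi>\<^sup>2) * (f y * ?e y)"
      unfolding heat_kernel_fourier_integral[OF t] by (simp add: mult_ac)
  qed
  finally show ?thesis
    unfolding fourier_def integral_mult_right_zero scaleR_conv_of_real
    by (simp only: mult.left_commute)
qed

end

(* Integrating the heat kernel against t^(b - 1) yields the Riesz kernel; the reflection and
   duplication formulas for Gamma identify the constants, which gives (i) and (ii), while (iii)
   splits the kernel at its singularity.

   For (iv), the Hilbert transform is the absolutely convergent integral
   Hf(y) = 1/(2 pi) INT (f(y + s) - f(y - s)) / s ds, so that after moving the heat kernel K_t onto
   f one is left with INT (K_t(s - z) - K_t(s + z)) / s ds for z = u - x. The quotient is
   INT_0^1 (z/t) K_t(s - z(2w - 1)) exp(- z^2 w(1 - w)/t) dw, and integrating in s, then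
   in t against t^(b - 1), then in w, produces a Gauss integral, a Gamma integral and a Beta
   integral, that is, the kernel sgn z |z|^(2b - 1) up to its constant. *)

theory Submission
  imports Defs
begin

section \<open>A Gamma integral in the inverse variable, and Fubini for nonnegative kernels\<close>

text \<open>The substitution \<open>u = a / t\<close> maps the half-line onto itself and turns this
  into Euler's integral for \<open>Gamma p\<close>. Every integral over the heat time
  \<open>t\<close> below is an instance.\<close>

lemma nn_integral_powr_exp_inverse:
  fixes p a :: real
  assumes p: "0 < p" and a: "0 < a"
  shows "(\<integral>\<^sup>+t. ennreal (indicator {0<..} t * (t powr (- p - 1) * exp (- a / t))) \<partial>lborel)
    = ennreal (a powr (- p) * Gamma p)"
proof -
  let ?f = "\<lambda>u::real. u powr (p - 1) / exp u"
  have "(?f has_integral Gamma p) {0<..}"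
    using Gamma_integral_real[OF p]
    by (rule has_integral_spike_set_eq[THEN iffD1, rotated -1])
      (auto intro!: negligible_subset[OF negligible_sing[of 0]])
  moreover have "(\<lambda>t::real. a / t) ` {0<..} = {0<..}"
  proof (intro equalityI subsetI)
    fix u :: real assume "u \<in> {0<..}"
    then show "u \<in> (\<lambda>t. a / t) ` {0<..}"
      using a by (intro image_eqI[of _ _ "a / u"]) auto
  qed (use a in auto)
  ultimately have "?f absolutely_integrable_on (\<lambda>t. a / t) ` {0<..}
      \<and> integral ((\<lambda>t. a / t) ` {0<..}) ?f = Gamma p"
    by (auto intro!: nonnegative_absolutely_integrable_1)
  then have "(\<lambda>t. \<bar>- a / t\<^sup>2\<bar> * ?f (a / t)) absolutely_integrable_on {0<..}
      \<and> integral {0<..} (\<lambda>t. \<bar>- a / t\<^sup>2\<bar> * ?f (a / t)) = Gamma p"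
    by (rule has_absolute_integral_change_of_variables_1'[where g = "\<lambda>t. a / t"
          and g' = "\<lambda>t. - a / t\<^sup>2" and f = ?f, THEN iffD2, rotated -1])
      (use a in \<open>auto intro!: derivative_eq_intros inj_onI simp: power2_eq_square\<close>)
  then have "((\<lambda>t. \<bar>- a / t\<^sup>2\<bar> * ?f (a / t)) has_integral Gamma p) {0<..}"
    using has_integral_iff set_lebesgue_integral_eq_integral(1) by blast
  \<comment> \<open>The Jacobian times \<open>?f (a / t)\<close> equals
    \<open>a powr p * t powr (- p - 1) * exp (- a / t)\<close>; the factor
    \<open>a powr (- p)\<close> removes the surplus power of \<open>a\<close>.\<close>
  then have "((\<lambda>t. a powr (- p) * (\<bar>- a / t\<^sup>2\<bar> * ?f (a / t))) has_integral a powr (- p) * Gamma p) {0<..}"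
    by (rule has_integral_mult_right)
  moreover have "a powr (- p) * (\<bar>- a / t\<^sup>2\<bar> * ?f (a / t)) = t powr (- p - 1) * exp (- a / t)"
    if "t \<in> {0<..}" for t
  proof -
    have "t > 0" using that by simp
    then have "t\<^sup>2 = t powr 2" by (simp add: powr_numeral)
    then show ?thesis
      using a \<open>t > 0\<close>
      by (simp add: powr_divide powr_diff powr_minus exp_minus field_simps power2_eq_square)
  qed
  ultimately have "((\<lambda>t. t powr (- p - 1) * exp (- a / t)) has_integral a powr (- p) * Gamma p) {0<..}"
    by (rule has_integral_eq[rotated])
  from nn_integral_has_integral_lebesgue[OF _ this] show ?thesis
    by simp
qed

text \<open>The point \<open>x\<close> is exempt because a Riesz kernel is infinite on the diagonal, where \<open>powr\<close>
  returns \<open>0\<close>.\<close>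

lemma integral_nonneg_kernel_swap:
  fixes f :: "real \<Rightarrow> complex" and \<phi> :: "real \<Rightarrow> real \<Rightarrow> real"
  assumes \<phi>: "case_prod \<phi> \<in> borel_measurable (lborel \<Otimes>\<^sub>M lborel)"
    and f: "f \<in> borel_measurable borel"
    and nonneg: "\<And>t u. 0 \<le> \<phi> t u"
    and \<psi>: "\<And>u. u \<noteq> x \<Longrightarrow> (\<integral>\<^sup>+t. ennreal (\<phi> t u) \<partial>lborel) = ennreal (\<psi> u)"
    and \<psi>_nonneg: "\<And>u. 0 \<le> \<psi> u"
    and int: "integrable lborel (\<lambda>u. \<psi> u *\<^sub>R f u)"
  shows "(\<integral>t. (\<integral>u. \<phi> t u *\<^sub>R f u \<partial>lborel) \<partial>lborel) = (\<integral>u. \<psi> u *\<^sub>R f u \<partial>lborel)"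
proof -
  note [measurable] = \<phi> f
  have int1: "integrable lborel (\<lambda>t. \<phi> t u)" and int2: "(\<integral>t. \<phi> t u \<partial>lborel) = \<psi> u" if "u \<noteq> x" for u
  proof -
    have "has_bochner_integral lborel (\<lambda>t. \<phi> t u) (\<psi> u)"
      using \<psi>[OF that] \<psi>_nonneg nonneg by (intro has_bochner_integral_nn_integral) auto
    then show "integrable lborel (\<lambda>t. \<phi> t u)" "(\<integral>t. \<phi> t u \<partial>lborel) = \<psi> u"
      by (auto simp: has_bochner_integral_iff)
  qed
  have ae: "AE u in lborel. u \<noteq> x"
    by (rule AE_lborel_singleton)
  \<comment> \<open>Since \<phi> is nonnegative, integrating the norm over \<open>t\<close> gives
    \<open>\<psi> u * norm (f u)\<close> off the point \<open>x\<close>. Integrability on the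
    product thus reduces to that of \<open>\<psi> u *\<^sub>R f u\<close>.\<close>
  have "integrable (lborel \<Otimes>\<^sub>M lborel) (case_prod (\<lambda>u t. \<phi> t u *\<^sub>R f u))"
  proof (rule lborel_pair.Fubini_integrable)
    have "integrable lborel (\<lambda>u. norm (\<psi> u *\<^sub>R f u))"
      using int by (rule integrable_norm)
    then show "integrable lborel (\<lambda>u. \<integral>t. norm (case_prod (\<lambda>u t. \<phi> t u *\<^sub>R f u) (u, t)) \<partial>lborel)"
    proof (rule integrable_cong_AE_imp)
      show "AE u in lborel. norm (\<psi> u *\<^sub>R f u)
          = (\<integral>t. norm (case_prod (\<lambda>u t. \<phi> t u *\<^sub>R f u) (u, t)) \<partial>lborel)"
        using ae by eventually_elim (simp add: nonneg \<psi>_nonneg int2)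
    qed measurable
    show "AE u in lborel. integrable lborel (\<lambda>t. case_prod (\<lambda>u t. \<phi> t u *\<^sub>R f u) (u, t))"
      using ae by eventually_elim (simp add: int1)
  qed measurable
  from lborel_pair.Fubini_integral[OF this]
  have "(\<integral>t. (\<integral>u. \<phi> t u *\<^sub>R f u \<partial>lborel) \<partial>lborel) = (\<integral>u. (\<integral>t. \<phi> t u *\<^sub>R f u \<partial>lborel) \<partial>lborel)" .
  also have "\<dots> = (\<integral>u. \<psi> u *\<^sub>R f u \<partial>lborel)"
  proof (rule integral_cong_AE)
    show "AE u in lborel. (\<integral>t. \<phi> t u *\<^sub>R f u \<partial>lborel) = \<psi> u *\<^sub>R f u"
      using ae by eventually_elim (simp add: int1 int2)
    show "(\<lambda>u. \<psi> u *\<^sub>R f u) \<in> borel_measurable lborel"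
      using int by (rule borel_measurable_integrable)
  qed measurable
  finally show ?thesis .
qed

section \<open>The heat kernel, Gamma identities and the Riesz kernel\<close>

lemma heat_kernel_measurable [measurable]:
  "(\<lambda>(t, z). heat_kernel t z) \<in> borel_measurable (borel \<Otimes>\<^sub>M borel)"
  unfolding heat_kernel_def by measurable

lemma heat_kernel_minus [simp]: "heat_kernel t (- z) = heat_kernel t z"
  by (simp add: heat_kernel_def)

lemma heat_kernel_nonneg: "0 < t \<Longrightarrow> 0 \<le> heat_kernel t z"
  by (simp add: heat_kernel_def)

lemma nn_integral_heat_kernel:
  assumes "t > 0"
  shows "(\<integral>\<^sup>+s. ennreal (heat_kernel t (s - c)) \<partial>lborel) = 1"
proof -
  have "(\<integral>\<^sup>+s. ennreal (heat_kernel t (s - c)) \<partial>lborel)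
      = (\<integral>\<^sup>+s. ennreal (normal_density c (sqrt (2 * t)) s) \<partial>lborel)"
    by (simp add: heat_kernel_eq_normal_density[OF assms] normal_density_def)
  then show ?thesis
    using assms prob_space.emeasure_space_1[OF prob_space_normal_density[of "sqrt (2 * t)" c]]
    by (simp add: emeasure_density)
qed

text \<open>Read off from the complex identity. At integers both sides are 0: one of the Gamma
  values sits at a pole, where it is 0 by convention, and the right side divides by 0.\<close>

lemma Gamma_reflection_real:
  fixes x :: real
  shows "Gamma x * Gamma (1 - x) = pi / sin (pi * x)"
proof -
  have "complex_of_real (Gamma x * Gamma (1 - x)) = complex_of_real (pi / sin (pi * x))"
    using Gamma_reflection_complex[of "of_real x"]
    by (simp add: Gamma_complex_of_real[symmetric] sin_of_real[symmetric])
  then show ?thesis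
    by (simp only: of_real_eq_iff)
qed

lemma Gamma_legendre_duplication_real:
  fixes x :: real
  assumes "0 < x"
  shows "Gamma x * Gamma (x + 1/2) = 2 powr (1 - 2 * x) * sqrt pi * Gamma (2 * x)"
proof -
  have "complex_of_real x \<notin> \<int>\<^sub>\<le>\<^sub>0" "complex_of_real x + 1/2 \<notin> \<int>\<^sub>\<le>\<^sub>0"
    using assms by (auto elim!: nonpos_Ints_cases simp: complex_eq_iff)
  from Gamma_legendre_duplication[OF this]
  have "complex_of_real (Gamma x * Gamma (x + 1/2))
      = complex_of_real (2 powr (1 - 2 * x) * sqrt pi * Gamma (2 * x))"
    by (simp add: Gamma_complex_of_real[symmetric] powr_def exp_of_real[symmetric])
  then show ?thesis
    by (simp only: of_real_eq_iff)
qed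

text \<open>Up to \<open>1 / (2 * sqrt pi)\<close> the integrand is that of
  \<open>nn_integral_powr_exp_inverse\<close> with \<open>p = 1/2 - \<beta>\<close> and
  \<open>a = z\<^sup>2 / 4\<close>; here \<open>\<beta> < 1/2\<close> makes \<open>p\<close>
  positive and \<open>z \<noteq> 0\<close> makes \<open>a\<close> positive.\<close>

lemma powr_nn_integral_heat_kernel:
  assumes \<beta>: "0 < \<beta>" "\<beta> < 1/2" and z: "z \<noteq> 0"
  shows "(\<integral>\<^sup>+t. ennreal (indicator {0<..} t * (inverse (t powr (1 - \<beta>)) * heat_kernel t z)) \<partial>lborel)
    = ennreal (Gamma \<beta> * Gamma (1 - 2 * \<beta>) * sin (pi * \<beta>) / pi * \<bar>z\<bar> powr (2 * \<beta> - 1))"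
proof -
  have sin_pos: "sin (pi * \<beta>) > 0"
    using \<beta> by (intro sin_gt_zero) auto
  have "indicator {0<..} t * (inverse (t powr (1 - \<beta>)) * heat_kernel t z)
      = (1 / (2 * sqrt pi)) *
        (indicator {0<..} t * (t powr (- (1/2 - \<beta>) - 1) * exp (- (z\<^sup>2 / 4) / t)))" for t
  proof (cases "t > 0")
    case True
    have e: "- (1/2 - \<beta>) - 1 = - (1 - \<beta>) - 1/2" by simp
    have "inverse (sqrt t) = t powr (- (1/2))"
      using True by (simp add: powr_minus powr_half_sqrt)
    then show ?thesis
      using True unfolding e
      by (simp only: heat_kernel_def powr_diff powr_minus)
        (simp add: real_sqrt_mult powr_half_sqrt field_simps)
  qed simp
  then have "(\<integral>\<^sup>+t. ennreal (indicator {0<..} t * (inverse (t powr (1 - \<beta>)) * heat_kernel t z)) \<partial>lborel)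
     = (\<integral>\<^sup>+t. ennreal (1 / (2 * sqrt pi)) * ennreal (indicator {0<..} t *
         (t powr (- (1/2 - \<beta>) - 1) * exp (- (z\<^sup>2 / 4) / t))) \<partial>lborel)"
    by (simp only: ennreal_mult'[symmetric] divide_nonneg_nonneg zero_le_one mult_nonneg_nonneg
          zero_le_numeral real_sqrt_ge_zero pi_ge_zero)
  also have "\<dots> = ennreal (1 / (2 * sqrt pi)) * ennreal ((z\<^sup>2 / 4) powr (- (1/2 - \<beta>)) * Gamma (1/2 - \<beta>))"
    using \<beta> z by (subst nn_integral_cmult, measurable, subst nn_integral_powr_exp_inverse) auto
  also have "\<dots> = ennreal (1 / (2 * sqrt pi) * ((z\<^sup>2 / 4) powr (- (1/2 - \<beta>)) * Gamma (1/2 - \<beta>)))"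
    by (rule ennreal_mult'[symmetric]) simp
  also have "1 / (2 * sqrt pi) * ((z\<^sup>2 / 4) powr (- (1/2 - \<beta>)) * Gamma (1/2 - \<beta>))
      = Gamma \<beta> * Gamma (1 - 2 * \<beta>) * sin (pi * \<beta>) / pi * \<bar>z\<bar> powr (2 * \<beta> - 1)"
  \<comment> \<open>Duplication at \<open>1/2 - \<beta>\<close> replaces
    \<open>Gamma (1/2 - \<beta>)\<close> by
    \<open>Gamma (1 - 2 * \<beta>) / Gamma (1 - \<beta>)\<close> and a power of 2, which cancels the
    one from \<open>z\<^sup>2 / 4\<close>. Reflection at \<beta> then brings in
    \<open>Gamma \<beta>\<close> and the sine.\<close>
  proof -
    have "z\<^sup>2 / 4 = (\<bar>z\<bar> / 2) powr 2"
      using z by (simp add: powr_numeral power_divide)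
    then have "(z\<^sup>2 / 4) powr (- (1/2 - \<beta>)) = (\<bar>z\<bar> / 2) powr (2 * \<beta> - 1)"
      by (simp only: powr_powr) (simp add: algebra_simps)
    also have "\<dots> = \<bar>z\<bar> powr (2 * \<beta> - 1) * 2 / 2 powr (2 * \<beta>)"
      by (simp add: powr_divide powr_diff)
    finally have 1: "(z\<^sup>2 / 4) powr (- (1/2 - \<beta>)) = \<bar>z\<bar> powr (2 * \<beta> - 1) * 2 / 2 powr (2 * \<beta>)" .
    have L: "Gamma (1/2 - \<beta>) * Gamma (1 - \<beta>) = 2 powr (2 * \<beta>) * sqrt pi * Gamma (1 - 2 * \<beta>)"
      using Gamma_legendre_duplication_real[of "1/2 - \<beta>"] \<beta> by (simp add: algebra_simps)
    have pos: "Gamma (1 - \<beta>) > 0" "Gamma \<beta> > 0"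
      using \<beta> by (auto intro!: Gamma_real_pos)
    have R: "Gamma \<beta> * sin (pi * \<beta>) / pi = 1 / Gamma (1 - \<beta>)"
      using Gamma_reflection_real[of \<beta>] pos sin_pos by (simp add: field_simps)
    have "Gamma (1/2 - \<beta>) / (sqrt pi * 2 powr (2 * \<beta>)) = Gamma (1 - 2 * \<beta>) / Gamma (1 - \<beta>)"
      using L pos by (simp add: field_simps)
    also have "\<dots> = Gamma (1 - 2 * \<beta>) * (Gamma \<beta> * sin (pi * \<beta>) / pi)"
      unfolding R by simp
    finally have "Gamma (1/2 - \<beta>) / (sqrt pi * 2 powr (2 * \<beta>))
        = Gamma (1 - 2 * \<beta>) * (Gamma \<beta> * sin (pi * \<beta>) / pi)" .
    then have "Gamma (1/2 - \<beta>) / (sqrt pi * 2 powr (2 * \<beta>)) * \<bar>z\<bar> powr (2 * \<beta> - 1)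
        = Gamma (1 - 2 * \<beta>) * (Gamma \<beta> * sin (pi * \<beta>) / pi) * \<bar>z\<bar> powr (2 * \<beta> - 1)"
      by simp
    then show ?thesis
      unfolding 1 by (simp add: mult_ac)
  qed
  finally show ?thesis .
qed

section \<open>The conjugate heat kernel and its integral over time\<close>

text \<open>Integrated over \<open>s\<close>, this is \<open>- 2 * pi\<close> times the Hilbert transform of the heat kernel
  at \<open>z\<close>.\<close>

definition conj_quotient :: "real \<Rightarrow> real \<Rightarrow> real \<Rightarrow> real" where
  "conj_quotient t z s = (heat_kernel t (s - z) - heat_kernel t (s + z)) / s"

lemma conj_quotient_measurable [measurable (raw)]:
  assumes [measurable]: "f \<in> borel_measurable M" "g \<in> borel_measurable M" "h \<in> borel_measurable M"
  shows "(\<lambda>x. conj_quotient (f x) (g x) (h x)) \<in> borel_measurable M"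
  unfolding conj_quotient_def heat_kernel_def by measurable

text \<open>Oddness in \<open>z\<close> allows \<open>sgn z\<close> to be split off, leaving the
  quotient at \<open>\<bar>z\<bar>\<close>, where it is nonnegative.\<close>

lemma conj_quotient_minus [simp]: "conj_quotient t (- z) s = - conj_quotient t z s"
  by (simp add: conj_quotient_def minus_divide_left)

text \<open>For \<open>s > 0\<close> the point \<open>s - z\<close> is at least as close to 0 as
  \<open>s + z\<close>, and for \<open>s < 0\<close> it is the other way round, so numerator and
  denominator never have opposite signs. At \<open>s = 0\<close> the quotient is 0.\<close>

lemma conj_quotient_nonneg:
  assumes "t > 0" "z \<ge> 0"
  shows "conj_quotient t z s \<ge> 0"
proof (cases "s > 0")
  case True
  then have "(s - z)\<^sup>2 \<le> (s + z)\<^sup>2"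
    using assms by (simp add: power2_eq_square algebra_simps)
  then have "heat_kernel t (s + z) \<le> heat_kernel t (s - z)"
    using assms by (auto simp: heat_kernel_def intro!: divide_right_mono)
  then show ?thesis using True by (simp add: conj_quotient_def)
next
  case False
  then have "(s + z)\<^sup>2 \<le> (s - z)\<^sup>2"
    using assms by (simp add: power2_eq_square algebra_simps mult_nonpos_nonneg)
  then have "heat_kernel t (s - z) \<le> heat_kernel t (s + z)"
    using assms by (auto simp: heat_kernel_def intro!: divide_right_mono)
  then show ?thesis using False by (simp add: conj_quotient_def divide_nonpos_nonpos)
qed

text \<open>The integrand is the derivative in \<open>w\<close> of a function running from \<open>heat_kernel t (s + z) / s\<close>
  to \<open>heat_kernel t (s - z) / s\<close>. It is nonnegative, so the integrals over \<open>s\<close>, \<open>w\<close> and \<open>t\<close>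
  can be taken in any order.\<close>

lemma conj_quotient_eq_nn_integral:
  assumes t: "t > 0" and z: "z > 0" and s: "s \<noteq> 0"
  shows "ennreal (conj_quotient t z s)
    = (\<integral>\<^sup>+w. ennreal (z / t * exp (- (z\<^sup>2 * (w * (1 - w))) / t)) * indicator {0..1} w
        * ennreal (heat_kernel t (s - z * (2 * w - 1))) \<partial>lborel)"
proof -
  \<comment> \<open>The exponent is linear in \<open>w\<close> and equals
    \<open>- (s + z)\<^sup>2 / (4 * t)\<close> at 0 and \<open>- (s - z)\<^sup>2 / (4 * t)\<close>
    at 1. Its slope \<open>s * z / t\<close> cancels the \<open>s\<close> in the denominator of
    \<open>?F\<close>, so no singularity is left in the integrand.\<close>
  let ?e = "\<lambda>w. exp (- (s\<^sup>2 + z\<^sup>2) / (4 * t) + s * z * (2 * w - 1) / (2 * t))"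
  let ?F = "\<lambda>w. ?e w / (s * sqrt (4 * pi * t))"
  have "(\<integral>\<^sup>+w. ennreal (z / t * ?e w / sqrt (4 * pi * t)) * indicator {0..1} w \<partial>lborel) = ?F 1 - ?F 0"
  proof (rule nn_integral_FTC_Icc)
    fix w
    show "(?F has_real_derivative z / t * ?e w / sqrt (4 * pi * t)) (at w)"
      using t s by (auto intro!: derivative_eq_intros simp: field_simps)
  qed (use t z in auto)
  moreover have "?F 1 - ?F 0 = conj_quotient t z s"
  proof -
    have "- (s\<^sup>2 + z\<^sup>2) / (4 * t) + s * z * (2 * 1 - 1) / (2 * t) = - ((s - z)\<^sup>2) / (4 * t)"
      "- (s\<^sup>2 + z\<^sup>2) / (4 * t) + s * z * (2 * 0 - 1) / (2 * t) = - ((s + z)\<^sup>2) / (4 * t)"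
      using t by (simp_all add: field_simps power2_eq_square)
    then show ?thesis
      using s t by (simp add: conj_quotient_def heat_kernel_def diff_divide_distrib mult.commute)
  qed
  \<comment> \<open>Completing the square in \<open>s\<close> centres the Gaussian at
    \<open>z * (2 * w - 1)\<close>; the remainder comes from
    \<open>1 - (2 * w - 1)\<^sup>2 = 4 * w * (1 - w)\<close>.\<close>
  moreover have "z / t * ?e w / sqrt (4 * pi * t)
      = z / t * exp (- (z\<^sup>2 * (w * (1 - w))) / t) * heat_kernel t (s - z * (2 * w - 1))" for w
  proof -
    have "- (s\<^sup>2 + z\<^sup>2) / (4 * t) + s * z * (2 * w - 1) / (2 * t)
        = - (z\<^sup>2 * (w * (1 - w))) / t + - ((s - z * (2 * w - 1))\<^sup>2) / (4 * t)"
      using t by (simp add: field_simps power2_eq_square)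
    then show ?thesis
      by (simp only: heat_kernel_def exp_add) simp
  qed
  ultimately show ?thesis
    using t z by (simp add: ennreal_mult heat_kernel_nonneg ac_simps del: times_divide_eq_left times_divide_eq_right)
qed

text \<open>By Tonelli the integral over \<open>s\<close> can be taken first. For fixed
  \<open>w\<close> it meets a translated heat kernel, of mass 1, so only the weight in
  \<open>w\<close> survives.\<close>

lemma nn_integral_conj_quotient:
  assumes t: "t > 0" and z: "z > 0"
  shows "(\<integral>\<^sup>+s. ennreal (conj_quotient t z s) \<partial>lborel)
    = (\<integral>\<^sup>+w. ennreal (z / t * exp (- (z\<^sup>2 * (w * (1 - w))) / t)) * indicator {0..1} w \<partial>lborel)"
proof -
  let ?g = "\<lambda>w::real. ennreal (z / t * exp (- (z\<^sup>2 * (w * (1 - w))) / t)) * indicator {0..1} w"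
  have "(\<integral>\<^sup>+s. ennreal (conj_quotient t z s) \<partial>lborel)
      = (\<integral>\<^sup>+s. (\<integral>\<^sup>+w. ?g w * ennreal (heat_kernel t (s - z * (2 * w - 1))) \<partial>lborel) \<partial>lborel)"
    using AE_lborel_singleton[of 0]
    by (intro nn_integral_cong_AE, eventually_elim) (rule conj_quotient_eq_nn_integral[OF t z])
  also have "\<dots> = (\<integral>\<^sup>+w. (\<integral>\<^sup>+s. ?g w * ennreal (heat_kernel t (s - z * (2 * w - 1))) \<partial>lborel) \<partial>lborel)"
    by (rule lborel_pair.Fubini') measurable
  also have "\<dots> = (\<integral>\<^sup>+w. ?g w \<partial>lborel)"
    by (intro nn_integral_cong) (simp add: nn_integral_cmult nn_integral_heat_kernel[OF t])
  finally show ?thesis .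
qed

text \<open>On the unit interval the exponential is at most 1, so the weight in \<open>w\<close>
  integrates to at most \<open>z / t\<close>. This linear growth in \<open>z\<close> is mild enough
  to be absorbed by Schwartz decay in \<open>heat_hilbert\<close>.\<close>

lemma
  assumes t: "t > 0" and z: "z > 0"
  shows integrable_conj_quotient: "integrable lborel (conj_quotient t z)"
    and integral_conj_quotient: "ennreal (\<integral>s. conj_quotient t z s \<partial>lborel)
      = (\<integral>\<^sup>+w. ennreal (z / t * exp (- (z\<^sup>2 * (w * (1 - w))) / t)) * indicator {0..1} w \<partial>lborel)"
    and integral_conj_quotient_le: "(\<integral>s. conj_quotient t z s \<partial>lborel) \<le> z / t"
proof -
  have "(\<integral>\<^sup>+w. ennreal (z / t * exp (- (z\<^sup>2 * (w * (1 - w))) / t)) * indicator {0..1} w \<partial>lborel)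
      \<le> (\<integral>\<^sup>+w. ennreal (z / t) * indicator {0..1::real} w \<partial>lborel)"
  proof (rule nn_integral_mono)
    fix w :: real
    have "z / t * exp (- (z\<^sup>2 * (w * (1 - w))) / t) \<le> z / t" if "w \<in> {0..1}"
      using that t z by (intro mult_left_le) auto
    then show "ennreal (z / t * exp (- (z\<^sup>2 * (w * (1 - w))) / t)) * indicator {0..1} w
        \<le> ennreal (z / t) * indicator {0..1} w"
      by (auto simp: indicator_def simp del: times_divide_eq_left times_divide_eq_right intro!: ennreal_leI)
  qed
  also have "\<dots> = ennreal (z / t)"
    by (simp add: nn_integral_cmult)
  finally have le: "(\<integral>\<^sup>+s. ennreal (conj_quotient t z s) \<partial>lborel) \<le> ennreal (z / t)"
    by (simp only: nn_integral_conj_quotient[OF t z])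
  show int: "integrable lborel (conj_quotient t z)"
    using le t z by (intro integrableI_nonneg)
      (auto simp: conj_quotient_nonneg intro: le_less_trans)
  have eq: "ennreal (\<integral>s. conj_quotient t z s \<partial>lborel) = (\<integral>\<^sup>+s. ennreal (conj_quotient t z s) \<partial>lborel)"
    using int t z by (subst nn_integral_eq_integral) (auto simp: conj_quotient_nonneg)
  show "ennreal (\<integral>s. conj_quotient t z s \<partial>lborel)
      = (\<integral>\<^sup>+w. ennreal (z / t * exp (- (z\<^sup>2 * (w * (1 - w))) / t)) * indicator {0..1} w \<partial>lborel)"
    unfolding eq by (rule nn_integral_conj_quotient[OF t z])
  show "(\<integral>s. conj_quotient t z s \<partial>lborel) \<le> z / t"
    using le t z unfolding eq[symmetric] by (simp add: ennreal_le_iff)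
qed

text \<open>After exchanging \<open>t\<close> and \<open>w\<close>, the inner integral is
  \<open>nn_integral_powr_exp_inverse\<close> with \<open>p = 1 - \<beta>\<close> and
  \<open>a = z\<^sup>2 * (w * (1 - w))\<close>. The resulting \<open>a powr (- p)\<close> separates
  into a power of \<open>z\<close> and the integrand of \<open>Beta \<beta> \<beta>\<close>.\<close>

lemma powr_nn_integral_conj_quotient:
  assumes \<beta>: "0 < \<beta>" "\<beta> < 1" and z: "z > 0"
  shows "(\<integral>\<^sup>+t. ennreal (indicator {0<..} t * (inverse (t powr (1 - \<beta>))
      * (\<integral>s. conj_quotient t z s \<partial>lborel))) \<partial>lborel)
    = ennreal (Gamma (1 - \<beta>) * Beta \<beta> \<beta> * z powr (2 * \<beta> - 1))"
proof -
  let ?h = "\<lambda>t w. ennreal (indicator {0<..} t * (t powr (- (1 - \<beta>) - 1) * exp (- (z\<^sup>2 * (w * (1 - w))) / t)))"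
  have "ennreal (indicator {0<..} t * (inverse (t powr (1 - \<beta>)) * (\<integral>s. conj_quotient t z s \<partial>lborel)))
      = (\<integral>\<^sup>+w. ennreal z * indicator {0..1} w * ?h t w \<partial>lborel)" for t
  proof (cases "t > 0")
    case True
    have "ennreal (indicator {0<..} t * (inverse (t powr (1 - \<beta>)) * (\<integral>s. conj_quotient t z s \<partial>lborel)))
       = ennreal (inverse (t powr (1 - \<beta>))) * ennreal (\<integral>s. conj_quotient t z s \<partial>lborel)"
      using True by (simp add: ennreal_mult')
    also have "\<dots> = (\<integral>\<^sup>+w. ennreal (inverse (t powr (1 - \<beta>))) *
        (ennreal (z / t * exp (- (z\<^sup>2 * (w * (1 - w))) / t)) * indicator {0..1} w) \<partial>lborel)"
      unfolding integral_conj_quotient[OF True z] by (rule nn_integral_cmult[symmetric]) measurable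
    also have "\<dots> = (\<integral>\<^sup>+w. ennreal z * indicator {0..1} w * ?h t w \<partial>lborel)"
    proof (rule nn_integral_cong)
      fix w :: real
      have "inverse (t powr (1 - \<beta>)) * (z / t * exp (- (z\<^sup>2 * (w * (1 - w))) / t))
          = z * (t powr (- (1 - \<beta>) - 1) * exp (- (z\<^sup>2 * (w * (1 - w))) / t))"
        using True by (simp only: powr_diff powr_minus) (simp add: field_simps)
      then show "ennreal (inverse (t powr (1 - \<beta>))) *
        (ennreal (z / t * exp (- (z\<^sup>2 * (w * (1 - w))) / t)) * indicator {0..1} w)
          = ennreal z * indicator {0..1} w * ?h t w"
        using True z by (simp add: indicator_def ennreal_mult[symmetric])
    qed
    finally show ?thesis .
  qed simp
  then have "(\<integral>\<^sup>+t. ennreal (indicator {0<..} t * (inverse (t powr (1 - \<beta>))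
      * (\<integral>s. conj_quotient t z s \<partial>lborel))) \<partial>lborel)
      = (\<integral>\<^sup>+t. (\<integral>\<^sup>+w. ennreal z * indicator {0..1} w * ?h t w \<partial>lborel) \<partial>lborel)"
    by simp
  also have "\<dots> = (\<integral>\<^sup>+w. (\<integral>\<^sup>+t. ennreal z * indicator {0..1} w * ?h t w \<partial>lborel) \<partial>lborel)"
    by (rule lborel_pair.Fubini') measurable
  also have "\<dots> = (\<integral>\<^sup>+w. ennreal z * indicator {0..1} w * (\<integral>\<^sup>+t. ?h t w \<partial>lborel) \<partial>lborel)"
    by (intro nn_integral_cong nn_integral_cmult) measurable
  also have "\<dots> = (\<integral>\<^sup>+w. ennreal (Gamma (1 - \<beta>) * z powr (2 * \<beta> - 1)) *
      (ennreal (w powr (\<beta> - 1) * (1 - w) powr (\<beta> - 1)) * indicator {0..1} w) \<partial>lborel)"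
  proof (rule nn_integral_cong_AE)
    \<comment> \<open>The endpoints are excluded because there \<open>a = 0\<close>: the integral
      over \<open>t\<close> diverges, while the right side is 0 since
      \<open>0 powr (\<beta> - 1) = 0\<close>.\<close>
    have eq: "ennreal z * indicator {0..1} w * (\<integral>\<^sup>+t. ?h t w \<partial>lborel)
        = ennreal (Gamma (1 - \<beta>) * z powr (2 * \<beta> - 1)) *
          (ennreal (w powr (\<beta> - 1) * (1 - w) powr (\<beta> - 1)) * indicator {0..1} w)"
      if "w \<noteq> 0" "w \<noteq> 1" for w
    proof (cases "w \<in> {0..1}")
      case True
      then have w: "0 < w" "w < 1" using that by auto
      have G: "Gamma (1 - \<beta>) > 0"
        using \<beta> by (intro Gamma_real_pos) simp
      have "z * (z\<^sup>2) powr (- (1 - \<beta>)) = z powr (2 * \<beta> - 1)"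
      proof -
        have "(z\<^sup>2) powr (- (1 - \<beta>)) = z powr (2 * \<beta> - 2)"
          using z by (simp add: powr_powr powr_numeral[symmetric] algebra_simps del: powr_numeral)
        then show ?thesis
          using z by (simp add: powr_diff powr_numeral power2_eq_square)
      qed
      then have "z * ((z\<^sup>2 * (w * (1 - w))) powr (- (1 - \<beta>)) * Gamma (1 - \<beta>))
          = Gamma (1 - \<beta>) * z powr (2 * \<beta> - 1) * (w powr (\<beta> - 1) * (1 - w) powr (\<beta> - 1))"
        using w by (simp add: powr_mult)
      moreover have "(\<integral>\<^sup>+t. ?h t w \<partial>lborel) = ennreal ((z\<^sup>2 * (w * (1 - w))) powr (- (1 - \<beta>)) * Gamma (1 - \<beta>))"
        using \<beta> z w by (intro nn_integral_powr_exp_inverse) auto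
      ultimately show ?thesis
        using w z G by (simp add: ennreal_mult[symmetric] del: minus_diff_eq)
    qed simp
    show "AE w in lborel. ennreal z * indicator {0..1} w * (\<integral>\<^sup>+t. ?h t w \<partial>lborel)
        = ennreal (Gamma (1 - \<beta>) * z powr (2 * \<beta> - 1)) *
          (ennreal (w powr (\<beta> - 1) * (1 - w) powr (\<beta> - 1)) * indicator {0..1} w)"
      using AE_lborel_singleton[of 0] AE_lborel_singleton[of 1] by eventually_elim (rule eq)
  qed
  also have "\<dots> = ennreal (Gamma (1 - \<beta>) * z powr (2 * \<beta> - 1)) * ennreal (Beta \<beta> \<beta>)"
    using nn_integral_has_integral_lebesgue'[OF _ has_integral_Beta_real[OF \<beta>(1) \<beta>(1)]]
    by (subst nn_integral_cmult) auto
  also have "\<dots> = ennreal (Gamma (1 - \<beta>) * Beta \<beta> \<beta> * z powr (2 * \<beta> - 1))"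
    using \<beta> by (subst ennreal_mult'[symmetric]) (auto simp: ac_simps Gamma_real_nonneg)
  finally show ?thesis .
qed

section \<open>Schwartz functions: decay and integrability against singular kernels\<close>

lemma
  assumes f: "f \<in> schwartz"
  shows schwartz_differentiable: "f differentiable (at x)"
    and schwartz_measurable: "f \<in> borel_measurable borel"
    and schwartz_bounded_power: "bounded (range (\<lambda>x. x ^ k *\<^sub>R f x))"
proof -
  have "(\<forall>x. nth_vderiv 0 f differentiable (at x)) \<and>
      (\<forall>k::nat. bounded (range (\<lambda>x. x ^ k *\<^sub>R nth_vderiv 0 f x)))"
    using f unfolding schwartz_def by blast
  then show d: "f differentiable (at x)" and "bounded (range (\<lambda>x. x ^ k *\<^sub>R f x))" for x k
    by (auto simp: nth_vderiv_def)
  then have "continuous_on UNIV f"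
    by (auto simp: continuous_on_eq_continuous_at intro: differentiable_imp_continuous_within)
  then show "f \<in> borel_measurable borel"
    by (rule borel_measurable_continuous_onI)
qed

text \<open>The first derivative is bounded, so the mean value inequality applies. The constant
  later controls symmetric difference quotients near \<open>s = 0\<close>.\<close>

lemma schwartz_lipschitz:
  assumes f: "f \<in> schwartz"
  obtains L where "0 \<le> L" "\<And>x y. norm (f x - f y) \<le> L * \<bar>x - y\<bar>"
proof -
  have "bounded (range (\<lambda>x. x ^ 0 *\<^sub>R nth_vderiv 1 f x))"
    using f unfolding schwartz_def by blast
  then have "bounded (range (\<lambda>x. vector_derivative f (at x)))"
    by (simp add: nth_vderiv_def)
  then obtain L where L: "\<And>x. norm (vector_derivative f (at x)) \<le> L"
    by (auto simp: bounded_iff)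
  have "norm (f x - f y) \<le> L * norm (x - y)" for x y
  proof (rule differentiable_bound[of UNIV])
    fix z :: real
    show "(f has_derivative (\<lambda>h. h *\<^sub>R vector_derivative f (at z))) (at z within UNIV)"
      using schwartz_differentiable[OF f]
      by (simp add: vector_derivative_works has_vector_derivative_def)
    show "onorm (\<lambda>h. h *\<^sub>R vector_derivative f (at z)) \<le> L"
      using L[of z] by (simp add: onorm_scaleR_left onorm_id bounded_linear_ident)
  qed auto
  moreover have "0 \<le> L"
    using norm_ge_zero L[of 0] by (rule order_trans)
  ultimately show ?thesis
    using that by simp
qed

lemma integrable_inverse_one_plus_square: "integrable lborel (\<lambda>x::real. inverse (1 + x\<^sup>2))"
  using integrable_inverse_1_plus_square by (simp add: set_integrable_def)

text \<open>Bounds for the powers \<open>k\<close> and \<open>k + 2\<close> add up to a bound for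
  \<open>1 + x\<^sup>2\<close> times the function, which is therefore dominated by a multiple of
  \<open>inverse (1 + x\<^sup>2)\<close>.\<close>

lemma schwartz_integrable_power:
  assumes f: "f \<in> schwartz"
  shows "integrable lborel (\<lambda>x. x ^ k *\<^sub>R f x)"
proof -
  obtain A where A: "\<And>x. norm (x ^ k *\<^sub>R f x) \<le> A"
    using schwartz_bounded_power[OF f, of k] by (auto simp: bounded_iff)
  obtain B where B: "\<And>x. norm (x ^ (k + 2) *\<^sub>R f x) \<le> B"
    using schwartz_bounded_power[OF f, of "k + 2"] by (auto simp: bounded_iff)
  have bound: "norm (x ^ k *\<^sub>R f x) \<le> norm ((A + B) * inverse (1 + x\<^sup>2))" for x
  proof -
    have "norm (x ^ (k + 2) *\<^sub>R f x) = x\<^sup>2 * norm (x ^ k *\<^sub>R f x)"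
      by (simp add: power_add abs_mult power2_eq_square)
    then have "(1 + x\<^sup>2) * norm (x ^ k *\<^sub>R f x) \<le> A + B"
      using A[of x] B[of x] unfolding distrib_right mult_1 by linarith
    moreover have pos: "1 + x\<^sup>2 > 0"
      by (rule add_pos_nonneg) auto
    ultimately have "norm (x ^ k *\<^sub>R f x) \<le> (A + B) * inverse (1 + x\<^sup>2)"
      by (simp add: field_simps)
    then show ?thesis
      by (simp only: real_norm_def abs_of_nonneg[OF order_trans[OF norm_ge_zero]])
  qed
  note [measurable] = schwartz_measurable[OF f]
  show ?thesis
    using bound by (intro Bochner_Integration.integrable_bound[OF
          integrable_mult_right[OF integrable_inverse_one_plus_square, of "A + B"]]) auto
qed

lemma schwartz_integrable: "f \<in> schwartz \<Longrightarrow> integrable lborel f"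
  using schwartz_integrable_power[of f 0] by simp

lemma integrable_dist_mult_schwartz:
  assumes f: "f \<in> schwartz"
  shows "integrable lborel (\<lambda>u. \<bar>u - x\<bar> *\<^sub>R f u)"
proof (rule Bochner_Integration.integrable_bound)
  show "integrable lborel (\<lambda>u. u ^ 1 *\<^sub>R f u - x *\<^sub>R f u)"
    using schwartz_integrable_power[OF f, of 1] schwartz_integrable[OF f]
    by (intro Bochner_Integration.integrable_diff) auto
  show "(\<lambda>u. \<bar>u - x\<bar> *\<^sub>R f u) \<in> borel_measurable lborel"
    using schwartz_measurable[OF f] by measurable
qed (simp add: scaleR_diff_left[symmetric])

lemma integrable_powr_near_zero:
  fixes a :: real
  assumes "0 < a"
  shows "integrable lborel (\<lambda>v. indicator {-1..1} v * \<bar>v\<bar> powr (a - 1))"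
proof -
  let ?g = "\<lambda>v::real. indicator {0..1} v * v powr (a - 1)"
  have "((\<lambda>v. v powr (a - 1)) has_integral (1 powr (a - 1 + 1) / (a - 1 + 1))) {0..1}"
    using assms by (intro has_integral_powr_from_0) auto
  from nn_integral_has_integral_lebesgue[OF _ this]
  have g: "integrable lborel ?g"
    by (intro integrableI_nonneg) auto
  then have "integrable lborel (\<lambda>v. ?g v + ?g (0 + (-1) * v))"
    by (intro Bochner_Integration.integrable_add lborel_integrable_real_affine) auto
  \<comment> \<open>Both halves contain \<open>v = 0\<close>, but \<open>0 powr (a - 1) = 0\<close>,
    so the identity holds there as well.\<close>
  moreover have "?g v + ?g (0 + (-1) * v) = indicator {-1..1} v * \<bar>v\<bar> powr (a - 1)" for v
    by (auto simp: indicator_def)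
  ultimately show ?thesis
    by simp
qed

text \<open>Split at distance 1 from \<open>x\<close>: nearby, \<open>f\<close> is bounded and the
  singularity is integrable because \<open>a > 0\<close>; farther out, the kernel is at most 1
  because \<open>a < 1\<close>, and \<open>f\<close> itself is integrable.\<close>

lemma integrable_riesz_kernel:
  fixes a :: real
  assumes f: "f \<in> schwartz" and a: "0 < a" "a < 1"
  shows "integrable lborel (\<lambda>u. \<bar>u - x\<bar> powr (a - 1) *\<^sub>R f u)"
proof -
  obtain M where M: "\<And>u. norm (f u) \<le> M"
    using schwartz_bounded_power[OF f, of 0] by (auto simp: bounded_iff)
  let ?w = "\<lambda>v. indicator {-1..1} v * \<bar>v\<bar> powr (a - 1)"
  show ?thesis
  proof (rule Bochner_Integration.integrable_bound)
    show "integrable lborel (\<lambda>u. norm (f u) + M * ?w (- x + 1 * u))"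
      using schwartz_integrable[OF f]
      by (intro Bochner_Integration.integrable_add integrable_norm integrable_mult_right
            lborel_integrable_real_affine integrable_powr_near_zero a) auto
    show "(\<lambda>u. \<bar>u - x\<bar> powr (a - 1) *\<^sub>R f u) \<in> borel_measurable lborel"
      using schwartz_measurable[OF f] by measurable
    have "\<bar>u - x\<bar> powr (a - 1) * norm (f u) \<le> norm (f u) + M * ?w (- x + 1 * u)" for u
    proof (cases "\<bar>u - x\<bar> \<le> 1")
      case True
      then have "?w (- x + 1 * u) = \<bar>u - x\<bar> powr (a - 1)"
        by (auto simp: indicator_def)
      moreover have "\<bar>u - x\<bar> powr (a - 1) * norm (f u) \<le> M * \<bar>u - x\<bar> powr (a - 1)"
        using M[of u] by (simp add: mult.commute mult_right_mono)
      ultimately show ?thesis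
        by (simp only: add_increasing norm_ge_zero)
    next
      case False
      then have "\<bar>u - x\<bar> powr (a - 1) \<le> \<bar>u - x\<bar> powr 0"
        using a by (intro powr_mono) auto
      then have "\<bar>u - x\<bar> powr (a - 1) * norm (f u) \<le> 1 * norm (f u)"
        using False by (intro mult_right_mono) (auto split: if_splits)
      moreover have "?w (- x + 1 * u) = 0"
        using False by (auto simp: indicator_def)
      ultimately show ?thesis
        by (simp only: mult_zero_right add_0_right mult_1)
    qed
    then show "AE u in lborel. norm (\<bar>u - x\<bar> powr (a - 1) *\<^sub>R f u)
        \<le> norm (norm (f u) + M * ?w (- x + 1 * u))"
      unfolding norm_scaleR real_norm_def abs_of_nonneg[OF powr_ge_zero]
      by (intro AE_I2 order_trans[OF _ abs_ge_self])
  qed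
qed

section \<open>The Hilbert transform as an absolutely convergent integral\<close>

abbreviation sym_quotient :: "(real \<Rightarrow> complex) \<Rightarrow> real \<Rightarrow> real \<Rightarrow> complex" where
  "sym_quotient f y s \<equiv> (f (y + s) - f (y - s)) /\<^sub>R s"

lemma integrable_translate:
  fixes f :: "real \<Rightarrow> complex"
  assumes "integrable lborel f"
  shows "integrable lborel (\<lambda>s. f (y + s))" "integrable lborel (\<lambda>s. f (y - s))"
  using lborel_integrable_real_affine[OF assms, of 1 y]
    lborel_integrable_real_affine[OF assms, of "-1" y] by simp_all

lemma integral_translate:
  fixes f :: "real \<Rightarrow> 'a :: {banach, second_countable_topology}"
  shows "(\<integral>s. f (y + s) \<partial>lborel) = (\<integral>s. f s \<partial>lborel)" "(\<integral>s. f (y - s) \<partial>lborel) = (\<integral>s. f s \<partial>lborel)"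
  using lborel_integral_real_affine[of 1 f y] lborel_integral_real_affine[of "-1" f y] by simp_all

text \<open>For \<open>\<bar>s\<bar> \<le> 1\<close> the Lipschitz constant bounds the quotient by
  \<open>2 * L\<close>; elsewhere it is at most the sum of two translates of \<open>norm f\<close>.
  Translation invariance makes the resulting bound independent of \<open>y\<close>, as the Fubini
  argument in \<open>heat_hilbert\<close> requires.\<close>

lemma
  assumes f: "f \<in> schwartz"
  shows integrable_sym_quotient: "integrable lborel (sym_quotient f y)"
    and sym_quotient_bound: "\<exists>C. \<forall>y. (\<integral>s. norm (sym_quotient f y s) \<partial>lborel) \<le> C"
proof -
  obtain L where L: "0 \<le> L" "\<And>x y. norm (f x - f y) \<le> L * \<bar>x - y\<bar>"
    using schwartz_lipschitz[OF f] by blast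
  note [measurable] = schwartz_measurable[OF f]
  note int = schwartz_integrable[OF f]
  let ?h = "\<lambda>y s. 2 * L * indicator {-1..1} s + norm (f (y + s)) + norm (f (y - s))"
  have hint: "integrable lborel (?h y)" for y
    by (intro Bochner_Integration.integrable_add integrable_norm integrable_translate int) simp
  have bound: "norm (sym_quotient f y s) \<le> ?h y s" for y s
  proof (cases "s \<in> {-1..1}")
    case True
    have "norm (sym_quotient f y s) \<le> 2 * L"
    proof (cases "s = 0")
      case False
      have "norm (f (y + s) - f (y - s)) \<le> 2 * L * \<bar>s\<bar>"
        using L(2)[of "y + s" "y - s"] by (simp add: abs_mult)
      then show ?thesis
        using False by (simp only: norm_scaleR) (simp add: divide_simps mult.commute)
    qed (use L in simp)
    then show ?thesis
      using True by (simp add: add_increasing2)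
  next
    case False
    then have "\<bar>s\<bar> \<ge> 1" by auto
    then have "norm (sym_quotient f y s) \<le> 1 * norm (f (y + s) - f (y - s))"
      unfolding norm_scaleR by (intro mult_right_mono) (auto simp: inverse_le_1_iff)
    also have "\<dots> \<le> norm (f (y + s)) + norm (f (y - s))"
      using norm_triangle_ineq4 by simp
    finally show ?thesis
      using False by simp
  qed
  show sint: "integrable lborel (sym_quotient f y)" for y
    by (rule Bochner_Integration.integrable_bound[OF hint[of y]])
      (use bound in \<open>auto intro!: AE_I2 order_trans[OF _ abs_ge_self]\<close>)
  have "(\<integral>s. norm (sym_quotient f y s) \<partial>lborel) \<le> 4 * L + 2 * (\<integral>s. norm (f s) \<partial>lborel)" for y
  proof -
    have "(\<integral>s. norm (sym_quotient f y s) \<partial>lborel) \<le> (\<integral>s. ?h y s \<partial>lborel)"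
      using bound by (intro integral_mono integrable_norm sint hint)
    also have "\<dots> = 2 * L * 2 + (\<integral>s. norm (f (y + s)) \<partial>lborel) + (\<integral>s. norm (f (y - s)) \<partial>lborel)"
      using integrable_translate[OF int, of y] by (simp add: integrable_norm)
    also have "\<dots> = 4 * L + 2 * (\<integral>s. norm (f s) \<partial>lborel)"
      using integral_translate[of "\<lambda>s. norm (f s)" y] by simp
    finally show ?thesis .
  qed
  then show "\<exists>C. \<forall>y. (\<integral>s. norm (sym_quotient f y s) \<partial>lborel) \<le> C"
    by blast
qed

text \<open>The truncated domain is symmetric about \<open>y\<close>, so the substitutions
  \<open>t = y + s\<close> and \<open>t = y - s\<close> both give the same integral. Averaging them
  produces the symmetric quotient and the factor 1/2.\<close>

lemma truncated_hilbert_eq: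
  assumes f: "f \<in> schwartz" and e: "0 < e"
  shows "(LINT t:{t. e < \<bar>t - y\<bar>}|lborel. f t /\<^sub>R (t - y))
    = (1/2) *\<^sub>R (\<integral>s. indicator {s. e < \<bar>s\<bar>} s *\<^sub>R sym_quotient f y s \<partial>lborel)"
proof -
  note [measurable] = schwartz_measurable[OF f]
  let ?g = "\<lambda>t. indicator {t. e < \<bar>t - y\<bar>} t *\<^sub>R (f t /\<^sub>R (t - y))"
  have "integrable lborel ?g"
  proof (rule Bochner_Integration.integrable_bound)
    show "integrable lborel (\<lambda>t. (1 / e) *\<^sub>R f t)"
      using schwartz_integrable[OF f] by simp
    have "norm (?g t) \<le> norm ((1 / e) *\<^sub>R f t)" for t
    proof (cases "e < \<bar>t - y\<bar>")
      case True
      then show ?thesis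
        using e by (auto simp: divide_inverse intro!: mult_right_mono le_imp_inverse_le)
    qed simp
    then show "AE t in lborel. norm (?g t) \<le> norm ((1 / e) *\<^sub>R f t)"
      by simp
  qed measurable
  note g = integrable_translate[OF this, of y]
  have "2 *\<^sub>R (\<integral>t. ?g t \<partial>lborel) = (\<integral>s. ?g (y + s) \<partial>lborel) + (\<integral>s. ?g (y - s) \<partial>lborel)"
    unfolding integral_translate(1)[of ?g y] integral_translate(2)[of ?g y] by (rule scaleR_2)
  also have "\<dots> = (\<integral>s. ?g (y + s) + ?g (y - s) \<partial>lborel)"
    using g by (rule Bochner_Integration.integral_add[symmetric])
  also have "\<dots> = (\<integral>s. indicator {s. e < \<bar>s\<bar>} s *\<^sub>R sym_quotient f y s \<partial>lborel)"
    by (intro Bochner_Integration.integral_cong) (auto simp: indicator_def scaleR_diff_right)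
  finally have eq: "2 *\<^sub>R (\<integral>t. ?g t \<partial>lborel)
      = (\<integral>s. indicator {s. e < \<bar>s\<bar>} s *\<^sub>R sym_quotient f y s \<partial>lborel)" .
  show ?thesis
    unfolding set_lebesgue_integral_def eq[symmetric] by simp
qed

text \<open>The symmetrised integrand is absolutely integrable, so dominated convergence removes the
  cutoff. This also shows that the limit behind \<open>Lim\<close> exists.\<close>

lemma hilbert_eq_sym_quotient:
  assumes f: "f \<in> schwartz"
  shows "hilbert f y = (1 / (2 * pi)) *\<^sub>R (\<integral>s. sym_quotient f y s \<partial>lborel)"
proof -
  note [measurable] = schwartz_measurable[OF f]
  let ?J = "\<lambda>e. LINT t:{t. e < \<bar>t - y\<bar>}|lborel. f t /\<^sub>R (t - y)"
  have "(?J \<longlongrightarrow> (1/2) *\<^sub>R (\<integral>s. sym_quotient f y s \<partial>lborel)) (at_right 0)"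
  proof (rule tendsto_at_right_sequentially[of 0 1])
    fix S :: "nat \<Rightarrow> real"
    assume S: "\<And>n. 0 < S n" "S \<longlonglongrightarrow> 0"
    have "(\<lambda>n. \<integral>s. indicator {s. S n < \<bar>s\<bar>} s *\<^sub>R sym_quotient f y s \<partial>lborel)
        \<longlonglongrightarrow> (\<integral>s. sym_quotient f y s \<partial>lborel)"
    proof (rule integral_dominated_convergence[where w = "\<lambda>s. norm (sym_quotient f y s)"])
      show "AE s in lborel. (\<lambda>n. indicator {s. S n < \<bar>s\<bar>} s *\<^sub>R sym_quotient f y s)
          \<longlonglongrightarrow> sym_quotient f y s"
      proof (rule AE_I2)
        fix s :: real
        show "(\<lambda>n. indicator {s. S n < \<bar>s\<bar>} s *\<^sub>R sym_quotient f y s) \<longlonglongrightarrow> sym_quotient f y s"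
        proof (cases "s = 0")
          case False
          then have "eventually (\<lambda>n. S n < \<bar>s\<bar>) sequentially"
            using S(2) by (intro order_tendstoD(2)[of S 0]) auto
          then show ?thesis
            by (intro tendsto_eventually) (auto elim!: eventually_mono)
        qed simp
      qed
      show "integrable lborel (\<lambda>s. norm (sym_quotient f y s))"
        by (intro integrable_norm integrable_sym_quotient f)
    qed (auto simp: indicator_def)
    from tendsto_scaleR[OF tendsto_const[of "1/2"] this]
    show "(\<lambda>n. ?J (S n)) \<longlonglongrightarrow> (1/2) *\<^sub>R (\<integral>s. sym_quotient f y s \<partial>lborel)"
      by (simp only: truncated_hilbert_eq[OF f S(1)])
  qed simp
  then have "Lim (at_right 0) ?J = (1/2) *\<^sub>R (\<integral>s. sym_quotient f y s \<partial>lborel)"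
    by (intro tendsto_Lim) simp_all
  then show ?thesis
    by (simp add: hilbert_def)
qed

section \<open>The heat semigroup applied to a Hilbert transform\<close>

lemma integrable_heat_kernel_mult:
  assumes f: "f \<in> schwartz" and t: "t > 0"
  shows "integrable lborel (\<lambda>u. heat_kernel t (c - u) *\<^sub>R f u)"
proof (rule Bochner_Integration.integrable_bound)
  show "integrable lborel (\<lambda>u. (1 / sqrt (4 * pi * t)) *\<^sub>R f u)"
    using schwartz_integrable[OF f] by simp
  note [measurable] = schwartz_measurable[OF f]
  show "(\<lambda>u. heat_kernel t (c - u) *\<^sub>R f u) \<in> borel_measurable lborel"
    by measurable
  show "AE u in lborel. norm (heat_kernel t (c - u) *\<^sub>R f u) \<le> norm ((1 / sqrt (4 * pi * t)) *\<^sub>R f u)"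
    using t by (intro AE_I2) (auto simp: heat_kernel_def intro!: mult_right_mono divide_right_mono mult_left_le_one_le)
qed

text \<open>The translations \<open>u = y + s\<close> and \<open>u = y - s\<close> move the
  difference from \<open>f\<close> onto the heat kernel, whose evenness gives it the shape of
  \<open>conj_quotient\<close>.\<close>

lemma integral_heat_kernel_sym_quotient:
  assumes f: "f \<in> schwartz" and t: "t > 0"
  shows "(\<integral>y. heat_kernel t (x - y) *\<^sub>R sym_quotient f y s \<partial>lborel)
    = (\<integral>u. conj_quotient t (u - x) s *\<^sub>R f u \<partial>lborel)"
proof -
  let ?g = "\<lambda>c u. heat_kernel t (c - u) *\<^sub>R f u"
  note int = integrable_heat_kernel_mult[OF f t]
  have eq: "heat_kernel t (x - y) *\<^sub>R sym_quotient f y s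
      = (?g (x + s) (s + y) - ?g (x - s) (- s + y)) /\<^sub>R s" for y
    by (simp add: scaleR_diff_right mult.commute add.commute[of s y])
  have "(\<integral>y. heat_kernel t (x - y) *\<^sub>R sym_quotient f y s \<partial>lborel)
      = ((\<integral>y. ?g (x + s) (s + y) \<partial>lborel) - (\<integral>y. ?g (x - s) (- s + y) \<partial>lborel)) /\<^sub>R s"
    unfolding eq integral_scaleR_right
    by (subst Bochner_Integration.integral_diff) (intro integrable_translate int refl)+
  also have "\<dots> = ((\<integral>u. ?g (x + s) u \<partial>lborel) - (\<integral>u. ?g (x - s) u \<partial>lborel)) /\<^sub>R s"
    unfolding integral_translate(1)[of "?g (x + s)" s] integral_translate(1)[of "?g (x - s)" "- s"] ..
  also have "\<dots> = (\<integral>u. (?g (x + s) u - ?g (x - s) u) /\<^sub>R s \<partial>lborel)"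
    unfolding integral_scaleR_right by (subst Bochner_Integration.integral_diff) (intro int refl)+
  also have "\<dots> = (\<integral>u. conj_quotient t (u - x) s *\<^sub>R f u \<partial>lborel)"
  proof (rule Bochner_Integration.integral_cong[OF refl])
    fix u
    have "heat_kernel t (x - s - u) = heat_kernel t (s + (u - x))"
      using heat_kernel_minus[of t "x - s - u"] by (simp add: algebra_simps)
    moreover have "heat_kernel t (x + s - u) = heat_kernel t (s - (u - x))"
      by (simp add: algebra_simps)
    ultimately show "(?g (x + s) u - ?g (x - s) u) /\<^sub>R s = conj_quotient t (u - x) s *\<^sub>R f u"
      by (simp only: conj_quotient_def scaleR_diff_left[symmetric] scaleR_scaleR divide_inverse mult.commute)
  qed
  finally show ?thesis .
qed

text \<open>Two exchanges of integrals are made. Swapping \<open>y\<close> and \<open>s\<close>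
  rests on the uniform bound for symmetric quotients and the finite mass of the heat kernel;
  swapping \<open>s\<close> and \<open>u\<close> rests on the sign of
  \<open>conj_quotient\<close>.\<close>

lemma heat_hilbert:
  assumes f: "f \<in> schwartz" and t: "t > 0"
  shows "heat t (hilbert f) x = (1 / (2 * pi)) *\<^sub>R
    (\<integral>u. (\<integral>s. conj_quotient t \<bar>u - x\<bar> s \<partial>lborel) *\<^sub>R (sgn (u - x) *\<^sub>R f u) \<partial>lborel)"
proof -
  note [measurable] = schwartz_measurable[OF f]
  obtain C where C: "\<And>y. (\<integral>s. norm (sym_quotient f y s) \<partial>lborel) \<le> C"
    using sym_quotient_bound[OF f] by blast
  have C0: "0 \<le> C"
    by (rule order_trans[OF _ C]) simp
  have kernel_int: "integrable lborel (\<lambda>y. heat_kernel t (x - y))"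
  proof (rule integrableI_nonneg)
    have "(\<integral>\<^sup>+y. ennreal (heat_kernel t (x - y)) \<partial>lborel) = (\<integral>\<^sup>+y. ennreal (heat_kernel t (y - x)) \<partial>lborel)"
      by (simp add: heat_kernel_def power2_commute)
    then show "(\<integral>\<^sup>+y. ennreal (heat_kernel t (x - y)) \<partial>lborel) < \<infinity>"
      by (simp add: nn_integral_heat_kernel[OF t])
  qed (simp_all add: heat_kernel_nonneg[OF t])
  let ?k = "\<lambda>y s. heat_kernel t (x - y) *\<^sub>R sym_quotient f y s"
  have "integrable (lborel \<Otimes>\<^sub>M lborel) (case_prod ?k)"
  proof (rule lborel_pair.Fubini_integrable)
    show "integrable lborel (\<lambda>y. \<integral>s. norm (case_prod ?k (y, s)) \<partial>lborel)"
    proof (rule Bochner_Integration.integrable_bound)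
      show "integrable lborel (\<lambda>y. heat_kernel t (x - y) * C)"
        using kernel_int by simp
      show "AE y in lborel. norm (\<integral>s. norm (case_prod ?k (y, s)) \<partial>lborel) \<le> norm (heat_kernel t (x - y) * C)"
      proof (rule AE_I2)
        fix y
        have "(\<integral>s. norm (case_prod ?k (y, s)) \<partial>lborel)
            = heat_kernel t (x - y) * (\<integral>s. norm (sym_quotient f y s) \<partial>lborel)"
          using heat_kernel_nonneg[OF t]
          by (simp only: prod.case norm_scaleR[of "heat_kernel t (x - y)"] real_norm_def abs_of_nonneg
              integral_mult_right_zero)
        also have "\<dots> \<le> heat_kernel t (x - y) * C"
          by (intro mult_left_mono C heat_kernel_nonneg t)
        finally show "norm (\<integral>s. norm (case_prod ?k (y, s)) \<partial>lborel) \<le> norm (heat_kernel t (x - y) * C)"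
          unfolding real_norm_def
          by (subst abs_of_nonneg) (auto intro!: integral_nonneg_AE order_trans[OF _ abs_ge_self])
      qed
    qed measurable
    show "AE y in lborel. integrable lborel (\<lambda>s. case_prod ?k (y, s))"
      unfolding prod.case by (intro AE_I2 integrable_scaleR_right integrable_sym_quotient f)
  qed measurable
  from lborel_pair.Fubini_integral[OF this]
  have swap: "(\<integral>y. (\<integral>s. ?k y s \<partial>lborel) \<partial>lborel) = (\<integral>s. (\<integral>y. ?k y s \<partial>lborel) \<partial>lborel)" ..
  have "heat t (hilbert f) x = (\<integral>y. (1 / (2 * pi)) *\<^sub>R (\<integral>s. ?k y s \<partial>lborel) \<partial>lborel)"
    unfolding heat_def hilbert_eq_sym_quotient[OF f]
    by (intro Bochner_Integration.integral_cong refl)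
      (subst integral_scaleR_right, simp only: scaleR_scaleR mult.commute)
  also have "\<dots> = (1 / (2 * pi)) *\<^sub>R (\<integral>s. (\<integral>u. conj_quotient t (u - x) s *\<^sub>R f u \<partial>lborel) \<partial>lborel)"
    unfolding integral_scaleR_right[where c = "1 / (2 * pi)"] swap integral_heat_kernel_sym_quotient[OF f t] ..
  \<comment> \<open>The sign of \<open>u - x\<close> is transferred to \<open>f\<close>, so that the
    kernel becomes nonnegative and \<open>integral_nonneg_kernel_swap\<close> applies.\<close>
  also have "(\<integral>s. (\<integral>u. conj_quotient t (u - x) s *\<^sub>R f u \<partial>lborel) \<partial>lborel)
      = (\<integral>s. (\<integral>u. conj_quotient t \<bar>u - x\<bar> s *\<^sub>R (sgn (u - x) *\<^sub>R f u) \<partial>lborel) \<partial>lborel)"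
  proof -
    have "conj_quotient t z s = conj_quotient t \<bar>z\<bar> s * sgn z" for z s
      by (cases z "0::real" rule: linorder_cases) (simp_all add: conj_quotient_def[of t 0])
    then have "conj_quotient t (u - x) s *\<^sub>R f u
        = conj_quotient t \<bar>u - x\<bar> s *\<^sub>R (sgn (u - x) *\<^sub>R f u)" for u s
      by (metis scaleR_scaleR)
    then show ?thesis
      by (simp only:)
  qed
  also have "\<dots> = (\<integral>u. (\<integral>s. conj_quotient t \<bar>u - x\<bar> s \<partial>lborel) *\<^sub>R (sgn (u - x) *\<^sub>R f u) \<partial>lborel)"
  proof (rule integral_nonneg_kernel_swap)
    show "0 \<le> conj_quotient t \<bar>u - x\<bar> s" for s u
      by (simp add: conj_quotient_nonneg t)
    then show nonneg: "0 \<le> (\<integral>s. conj_quotient t \<bar>u - x\<bar> s \<partial>lborel)" for u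
      by (simp add: integral_nonneg_AE)
    show "(\<integral>\<^sup>+s. ennreal (conj_quotient t \<bar>u - x\<bar> s) \<partial>lborel)
        = ennreal (\<integral>s. conj_quotient t \<bar>u - x\<bar> s \<partial>lborel)" if "u \<noteq> x" for u
      using that by (intro nn_integral_eq_integral integrable_conj_quotient t)
        (auto simp: conj_quotient_nonneg t)
    show "integrable lborel (\<lambda>u. (\<integral>s. conj_quotient t \<bar>u - x\<bar> s \<partial>lborel) *\<^sub>R (sgn (u - x) *\<^sub>R f u))"
    proof (rule Bochner_Integration.integrable_bound)
      show "integrable lborel (\<lambda>u. (1 / t) *\<^sub>R (\<bar>u - x\<bar> *\<^sub>R f u))"
        by (intro integrable_scaleR_right integrable_dist_mult_schwartz f)
      have "norm ((\<integral>s. conj_quotient t \<bar>u - x\<bar> s \<partial>lborel) *\<^sub>R (sgn (u - x) *\<^sub>R f u))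
          \<le> norm ((1 / t) *\<^sub>R (\<bar>u - x\<bar> *\<^sub>R f u))" for u
      proof (cases "u = x")
        case False
        then have "(\<integral>s. conj_quotient t \<bar>u - x\<bar> s \<partial>lborel) * norm (f u) \<le> \<bar>u - x\<bar> / t * norm (f u)"
          using t by (intro mult_right_mono integral_conj_quotient_le) auto
        then show ?thesis
          using t nonneg[of u] False by (simp add: abs_mult abs_sgn_eq)
      qed simp
      then show "AE u in lborel. norm ((\<integral>s. conj_quotient t \<bar>u - x\<bar> s \<partial>lborel) *\<^sub>R (sgn (u - x) *\<^sub>R f u))
          \<le> norm ((1 / t) *\<^sub>R (\<bar>u - x\<bar> *\<^sub>R f u))"
        by simp
    qed measurable
  qed measurable
  finally show ?thesis .
qed

section \<open>Negative powers of the Laplacian as potentials, and the four identities\<close>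

text \<open>Exchanging \<open>t\<close> and \<open>u\<close> leaves the time integral of the heat
  kernel, which is the Riesz kernel. Its factor \<open>Gamma \<beta>\<close> cancels against the
  normalisation of the negative power.\<close>

lemma neg_laplacian_neg_power_eq_riesz:
  assumes f: "f \<in> schwartz" and \<beta>: "0 < \<beta>" "\<beta> < 1/2"
  shows "neg_laplacian_neg_power \<beta> f x = (Gamma (1 - 2 * \<beta>) * sin (pi * \<beta>) / pi) *\<^sub>R
    (\<integral>u. \<bar>u - x\<bar> powr (2 * \<beta> - 1) *\<^sub>R f u \<partial>lborel)"
proof -
  note [measurable] = schwartz_measurable[OF f]
  let ?c = "Gamma \<beta> * Gamma (1 - 2 * \<beta>) * sin (pi * \<beta>) / pi"
  let ?\<phi> = "\<lambda>t u. indicator {0<..} t * (inverse (t powr (1 - \<beta>)) * heat_kernel t (x - u))"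
  have G: "Gamma \<beta> > 0" "Gamma (1 - 2 * \<beta>) > 0" "sin (pi * \<beta>) > 0"
    using \<beta> by (auto intro!: Gamma_real_pos sin_gt_zero)
  have "neg_laplacian_neg_power \<beta> f x = (1 / Gamma \<beta>) *\<^sub>R (\<integral>t. (\<integral>u. ?\<phi> t u *\<^sub>R f u \<partial>lborel) \<partial>lborel)"
    by (simp add: neg_laplacian_neg_power_def set_lebesgue_integral_def heat_def
        integral_scaleR_right[symmetric] del: integral_scaleR_right)
  also have "(\<integral>t. (\<integral>u. ?\<phi> t u *\<^sub>R f u \<partial>lborel) \<partial>lborel)
      = (\<integral>u. (?c * \<bar>u - x\<bar> powr (2 * \<beta> - 1)) *\<^sub>R f u \<partial>lborel)"
  proof (rule integral_nonneg_kernel_swap)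
    show "0 \<le> ?\<phi> t u" for t u
      by (auto simp: indicator_def heat_kernel_nonneg)
    show "(\<integral>\<^sup>+t. ennreal (?\<phi> t u) \<partial>lborel) = ennreal (?c * \<bar>u - x\<bar> powr (2 * \<beta> - 1))" if "u \<noteq> x" for u
      using powr_nn_integral_heat_kernel[OF \<beta>, of "x - u"] that by (simp add: abs_minus_commute)
    show "integrable lborel (\<lambda>u. (?c * \<bar>u - x\<bar> powr (2 * \<beta> - 1)) *\<^sub>R f u)"
      unfolding scaleR_scaleR[symmetric]
      using \<beta> by (intro integrable_scaleR_right integrable_riesz_kernel f) auto
    show "0 \<le> ?c * \<bar>u - x\<bar> powr (2 * \<beta> - 1)" for u
      using G by simp
  qed measurable
  also have "\<dots> = ?c *\<^sub>R (\<integral>u. \<bar>u - x\<bar> powr (2 * \<beta> - 1) *\<^sub>R f u \<partial>lborel)"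
    by (simp only: scaleR_scaleR[symmetric] integral_scaleR_right)
  finally show ?thesis
    using G by simp
qed

text \<open>The same exchange, with the conjugate kernel from \<open>heat_hilbert\<close> in place
  of the heat kernel and \<open>sgn (u - x) *\<^sub>R f u\<close> in place of
  \<open>f u\<close>.\<close>

lemma neg_laplacian_neg_power_hilbert_eq_riesz:
  assumes f: "f \<in> schwartz" and \<beta>: "0 < \<beta>" "\<beta> < 1/2"
  shows "neg_laplacian_neg_power \<beta> (hilbert f) x = (1 / (2 * Gamma (2 * \<beta>) * sin (pi * \<beta>))) *\<^sub>R
    (\<integral>u. \<bar>u - x\<bar> powr (2 * \<beta> - 1) *\<^sub>R (sgn (u - x) *\<^sub>R f u) \<partial>lborel)"
proof -
  note [measurable] = schwartz_measurable[OF f]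
  let ?c = "Gamma (1 - \<beta>) * Beta \<beta> \<beta>"
  let ?g = "\<lambda>u. sgn (u - x) *\<^sub>R f u"
  let ?\<phi> = "\<lambda>t u. indicator {0<..} t *
    (inverse (t powr (1 - \<beta>)) * (\<integral>s. conj_quotient t \<bar>u - x\<bar> s \<partial>lborel))"
  have G: "Gamma \<beta> > 0" "Gamma (1 - \<beta>) > 0" "Gamma (2 * \<beta>) > 0" "sin (pi * \<beta>) > 0"
    using \<beta> by (auto intro!: Gamma_real_pos sin_gt_zero)
  have "indicator {0<..} t *\<^sub>R (heat t (hilbert f) x /\<^sub>R (t powr (1 - \<beta>)))
      = (1 / (2 * pi)) *\<^sub>R (\<integral>u. ?\<phi> t u *\<^sub>R ?g u \<partial>lborel)" for t
  proof (cases "t > 0")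
    case True
    then show ?thesis
      by (simp only: heat_hilbert[OF f True] scaleR_scaleR[symmetric] integral_scaleR_right)
        (simp add: mult.commute)
  qed simp
  then have "neg_laplacian_neg_power \<beta> (hilbert f) x
      = (1 / Gamma \<beta>) *\<^sub>R ((1 / (2 * pi)) *\<^sub>R (\<integral>t. (\<integral>u. ?\<phi> t u *\<^sub>R ?g u \<partial>lborel) \<partial>lborel))"
    by (simp only: neg_laplacian_neg_power_def set_lebesgue_integral_def integral_scaleR_right)
  also have "(\<integral>t. (\<integral>u. ?\<phi> t u *\<^sub>R ?g u \<partial>lborel) \<partial>lborel)
      = (\<integral>u. (?c * \<bar>u - x\<bar> powr (2 * \<beta> - 1)) *\<^sub>R ?g u \<partial>lborel)"
  proof (rule integral_nonneg_kernel_swap)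
    show "0 \<le> ?\<phi> t u" for t u
      by (auto simp: indicator_def conj_quotient_nonneg intro!: integral_nonneg_AE)
    show "(\<integral>\<^sup>+t. ennreal (?\<phi> t u) \<partial>lborel) = ennreal (?c * \<bar>u - x\<bar> powr (2 * \<beta> - 1))" if "u \<noteq> x" for u
      using powr_nn_integral_conj_quotient[of \<beta> "\<bar>u - x\<bar>"] \<beta> that by simp
    have "integrable lborel (\<lambda>u. \<bar>u - x\<bar> powr (2 * \<beta> - 1) *\<^sub>R f u)"
      using \<beta> by (intro integrable_riesz_kernel f) auto
    then have "integrable lborel (\<lambda>u. \<bar>u - x\<bar> powr (2 * \<beta> - 1) *\<^sub>R ?g u)"
      by (rule Bochner_Integration.integrable_bound) (auto simp: abs_mult abs_sgn_eq)
    then show "integrable lborel (\<lambda>u. (?c * \<bar>u - x\<bar> powr (2 * \<beta> - 1)) *\<^sub>R ?g u)"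
      unfolding scaleR_scaleR[of ?c, symmetric] by (rule integrable_scaleR_right)
    show "0 \<le> ?c * \<bar>u - x\<bar> powr (2 * \<beta> - 1)" for u
      using G by (simp add: Beta_def)
  qed measurable
  also have "\<dots> = ?c *\<^sub>R (\<integral>u. \<bar>u - x\<bar> powr (2 * \<beta> - 1) *\<^sub>R ?g u \<partial>lborel)"
    by (simp only: scaleR_scaleR[of ?c, symmetric] integral_scaleR_right)
  also have "(1 / Gamma \<beta>) *\<^sub>R ((1 / (2 * pi)) *\<^sub>R (?c *\<^sub>R (\<integral>u. \<bar>u - x\<bar> powr (2 * \<beta> - 1) *\<^sub>R ?g u \<partial>lborel)))
      = (1 / (2 * Gamma (2 * \<beta>) * sin (pi * \<beta>))) *\<^sub>R (\<integral>u. \<bar>u - x\<bar> powr (2 * \<beta> - 1) *\<^sub>R ?g u \<partial>lborel)"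
  \<comment> \<open>\<open>Beta \<beta> \<beta>\<close> is
    \<open>(Gamma \<beta>)\<^sup>2 / Gamma (2 * \<beta>)\<close>. One factor
    \<open>Gamma \<beta>\<close> cancels the normalisation, and reflection turns the other, times
    \<open>Gamma (1 - \<beta>)\<close>, into \<open>pi / sin (pi * \<beta>)\<close>.\<close>
  proof -
    have "Gamma (1 - \<beta>) = pi / (sin (pi * \<beta>) * Gamma \<beta>)"
      using Gamma_reflection_real[of \<beta>] G by (simp add: field_simps)
    then have "1 / Gamma \<beta> * (1 / (2 * pi) * ?c) = 1 / (2 * Gamma (2 * \<beta>) * sin (pi * \<beta>))"
      using G by (simp add: Beta_def)
    then show ?thesis
      by (simp only: scaleR_scaleR)
  qed
  finally show ?thesis .
qed

text \<open>With the origin moved to \<open>x\<close>, the positive half-line gives the right-sided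
  integral and the reflected negative half-line the left-sided one. Integrability of the Riesz
  kernel permits the split.\<close>

lemma H_op_eq_D_diff:
  assumes f: "f \<in> schwartz" and \<alpha>: "0 < \<alpha>" "\<alpha> < 1"
  shows "H_op \<alpha> f x = (1 / (2 * sin (pi * \<alpha> / 2))) *\<^sub>R (D_right_neg \<alpha> f x - D_left_neg \<alpha> f x)"
proof -
  note [measurable] = schwartz_measurable[OF f]
  let ?k = "\<lambda>s. f (x + s) /\<^sub>R \<bar>s\<bar> powr (1 - \<alpha>)"
  have "integrable lborel (\<lambda>u. \<bar>u - x\<bar> powr (\<alpha> - 1) *\<^sub>R f u)"
    by (rule integrable_riesz_kernel[OF f \<alpha>])
  from integrable_translate(1)[OF this, of x]
  have k: "integrable lborel ?k"
    by (simp add: powr_minus[of _ "1 - \<alpha>", simplified])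
  have int: "integrable lborel (\<lambda>s. indicator A s *\<^sub>R ?k s)" if "A \<in> sets borel" for A
    using that by (intro integrable_mult_indicator k) simp
  have "(\<integral>t. (sgn (t - x) *\<^sub>R f t) /\<^sub>R (\<bar>t - x\<bar> powr (1 - \<alpha>)) \<partial>lborel)
      = (\<integral>s. (sgn s *\<^sub>R f (x + s)) /\<^sub>R (\<bar>s\<bar> powr (1 - \<alpha>)) \<partial>lborel)"
    by (subst integral_translate(1)[symmetric, of _ x]) simp
  \<comment> \<open>At \<open>s = 0\<close> both sides vanish, since \<open>sgn 0 = 0\<close> and
    neither half-line contains 0.\<close>
  also have "\<dots> = (\<integral>s. indicator {0<..} s *\<^sub>R ?k s - indicator {..<0} s *\<^sub>R ?k s \<partial>lborel)"
    by (intro Bochner_Integration.integral_cong) (auto simp: indicator_def sgn_if)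
  also have "\<dots> = (\<integral>s. indicator {0<..} s *\<^sub>R ?k s \<partial>lborel) - (\<integral>s. indicator {..<0} s *\<^sub>R ?k s \<partial>lborel)"
    by (intro Bochner_Integration.integral_diff int) auto
  also have "(\<integral>s. indicator {..<0} s *\<^sub>R ?k s \<partial>lborel) = (\<integral>s. indicator {..<0} (0 - s) *\<^sub>R ?k (0 - s) \<partial>lborel)"
    by (rule integral_translate(2)[symmetric])
  also have "\<dots> = (LINT t:{0<..}|lborel. f (x - t) /\<^sub>R (t powr (1 - \<alpha>)))"
    unfolding set_lebesgue_integral_def
    by (intro Bochner_Integration.integral_cong) (auto simp: indicator_def)
  also have "(\<integral>s. indicator {0<..} s *\<^sub>R ?k s \<partial>lborel) = (LINT t:{0<..}|lborel. f (x + t) /\<^sub>R (t powr (1 - \<alpha>)))"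
    unfolding set_lebesgue_integral_def
    by (intro Bochner_Integration.integral_cong) (auto simp: indicator_def)
  finally show ?thesis
    unfolding H_op_def D_right_neg_def D_left_neg_def
    by (simp add: scaleR_diff_right[symmetric])
qed

theorem proposition5p1:
  fixes \<alpha> :: real and f :: "real \<Rightarrow> complex"
  assumes "0 < \<alpha>" and "\<alpha> < 1" and "f \<in> schwartz"
  shows "(\<forall>x. kH_op \<alpha> f x = neg_laplacian_neg_power (\<alpha> / 2) f x) \<and>
         (\<forall>x. k_op \<alpha> f x = cot (pi * \<alpha> / 2) *\<^sub>R neg_laplacian_neg_power (\<alpha> / 2) f x) \<and>
         (\<forall>x. H_op \<alpha> f x = (1 / (2 * sin (pi * \<alpha> / 2))) *\<^sub>R (D_right_neg \<alpha> f x - D_left_neg \<alpha> f x)) \<and>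
         (\<forall>x. H_op \<alpha> f x = neg_laplacian_neg_power (\<alpha> / 2) (hilbert f) x)"
proof (intro conjI allI)
  fix x
  have half: "0 < \<alpha> / 2" "\<alpha> / 2 < 1/2"
    using assms by auto
  have inverse_powr: "inverse (\<bar>r\<bar> powr (1 - \<alpha>)) = \<bar>r\<bar> powr (\<alpha> - 1)" for r
    by (simp flip: powr_minus)
  let ?I = "\<integral>u. \<bar>u - x\<bar> powr (\<alpha> - 1) *\<^sub>R f u \<partial>lborel"
  have I: "(\<integral>y. f y /\<^sub>R (\<bar>x - y\<bar> powr (1 - \<alpha>)) \<partial>lborel) = ?I"
    by (simp add: inverse_powr abs_minus_commute)
  have L: "neg_laplacian_neg_power (\<alpha> / 2) f x = (Gamma (1 - \<alpha>) * sin (pi * \<alpha> / 2) / pi) *\<^sub>R ?I"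
    using neg_laplacian_neg_power_eq_riesz[OF assms(3) half] by simp
  show "kH_op \<alpha> f x = neg_laplacian_neg_power (\<alpha> / 2) f x"
    unfolding kH_op_def I L by simp
  \<comment> \<open>Multiplying by the cotangent replaces the sine by a cosine. Reflection at
    \<alpha> brings in \<open>1 / sin (pi * \<alpha>)\<close>, whose double-angle expansion cancels
    that cosine and leaves the constant of \<open>k_op\<close>.\<close>
  have "1 / (2 * Gamma \<alpha> * sin (pi * \<alpha> / 2))
      = cot (pi * \<alpha> / 2) * (Gamma (1 - \<alpha>) * sin (pi * \<alpha> / 2) / pi)"
  proof -
    have pos: "Gamma \<alpha> > 0" "sin (pi * \<alpha> / 2) > 0" "sin (pi * \<alpha>) > 0" "cos (pi * \<alpha> / 2) > 0"
      using assms by (auto intro!: Gamma_real_pos sin_gt_zero cos_gt_zero simp: mult_less_cancel_left1)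
    have "sin (pi * \<alpha>) = 2 * sin (pi * \<alpha> / 2) * cos (pi * \<alpha> / 2)"
      using sin_double[of "pi * \<alpha> / 2"] by simp
    moreover have "Gamma (1 - \<alpha>) = pi / (sin (pi * \<alpha>) * Gamma \<alpha>)"
      using Gamma_reflection_real[of \<alpha>] pos by (simp add: field_simps)
    ultimately show ?thesis
      using pos by (simp add: cot_def field_simps)
  qed
  then show "k_op \<alpha> f x = cot (pi * \<alpha> / 2) *\<^sub>R neg_laplacian_neg_power (\<alpha> / 2) f x"
    unfolding k_op_def I L by (simp only: scaleR_scaleR)
  show "H_op \<alpha> f x = (1 / (2 * sin (pi * \<alpha> / 2))) *\<^sub>R (D_right_neg \<alpha> f x - D_left_neg \<alpha> f x)"
    using H_op_eq_D_diff assms by blast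
  \<comment> \<open>For \<open>\<beta> = \<alpha> / 2\<close> the constant of the conjugate
    potential is exactly that of \<open>H_op\<close>, with the same orientation of the sign.\<close>
  show "H_op \<alpha> f x = neg_laplacian_neg_power (\<alpha> / 2) (hilbert f) x"
    unfolding H_op_def neg_laplacian_neg_power_hilbert_eq_riesz[OF assms(3) half]
    by (simp add: inverse_powr)
qed

end
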